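(* Let $(X,Y)$ be a random vector with nonnegative absolutely continuous components, joint density $f(x,y)$ and joint distribution function $F(s,t)=\mathbb P(X\le s,Y\le t)$. Let $s,t\ge 0$ be such that $F(s,t)>0$, and let $$\tilde a(x,y;s,t):=\frac{f(x,y)}{\int_0^t f(x,v)\,{\rm d}v\,\int_0^s f(u,y)\,{\rm d}u},\qquad 0\le x\le s,\ 0\le y\le t.$$ (i) If $\tilde a(x,y;s,t)\le \tilde a(s,t;s,t)$ for all $0\le x\le s$ and $0\le y\le t$, then $$\tilde M_{X,Y}(s,t)\le \log\tilde a(s,t;s,t)+\log F(s,t).$$ (ii) If $\tilde a(x,y;s,t)\ge \tilde a(s,t;s,t)$ for all $0\le x\le s$ and $0\le y\le t$, then $$\tilde M_{X,Y}(s,t)\ge \log\tilde a(s,t;s,t)+\log F(s,t).$$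
   Context: $\log$ is the natural logarithm. $(X,Y)$ has a joint density $f$ on $[0,\infty)^2$. For $s,t\ge0$ with $F(s,t)>0$, the bivariate dynamic past mutual information is $$\tilde M_{X,Y}(s,t):=\int_0^s{\rm d}x\int_0^t \tilde f_{X,Y}(x,y;s,t)\,\log\frac{\tilde f_{X,Y}(x,y;s,t)}{\tilde f_X(x;s,t)\,\tilde f_Y(y;s,t)}\,{\rm d}y,$$ where, for $0\le x\le s$, $0\le y\le t$, $$\tilde f_{X,Y}(x,y;s,t)=\frac{f(x,y)}{F(s,t)},\quad \tilde f_X(x;s,t)=\frac{1}{F(s,t)}\int_0^t f(x,y)\,{\rm d}y,\quad \tilde f_Y(y;s,t)=\frac{1}{F(s,t)}\int_0^s f(x,y)\,{\rm d}x$$ are the joint and marginal densities of $(X,Y)$ conditional on $\{X\le s,Y\le t\}$. Conventions: the integrand is $0$ where $f(x,y)=0$, and $\log 0=-\infty$; $\tilde a$ is considered at points where its denominator is positive, and it is understood that $(s,t)$ is such a point. *)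

theory Defs
  imports "HOL-Probability.Probability"
begin

definition joint_cdf :: "'a measure \<Rightarrow> ('a \<Rightarrow> real) \<Rightarrow> ('a \<Rightarrow> real) \<Rightarrow> real \<Rightarrow> real \<Rightarrow> real" where
  "joint_cdf M X Y s t = \<P>(\<omega> in M. X \<omega> \<le> s \<and> Y \<omega> \<le> t)"

(* Natural logarithm on [0, infinity] with log 0 = -infinity. *)
definition log_ennreal :: "ennreal \<Rightarrow> ereal" where
  "log_ennreal r =
    (if r = 0 then -\<infinity> else if r = \<infinity> then \<infinity> else ereal (ln (enn2real r)))"

(* Extended-real-valued Lebesgue integral: positive part minus negative part (e2ennreal maps
   negative numbers to 0).  The Bochner integral is unsuitable below, because it is 0 on
   non-integrable functions whereas mutual information can be infinite.  In the use below
   infinity - infinity does not arise, up to null sets of the outer variable: the negative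
   parts are finite because r * ln r >= r - 1. *)
definition set_ereal_integral :: "'b measure \<Rightarrow> 'b set \<Rightarrow> ('b \<Rightarrow> ereal) \<Rightarrow> ereal" where
  "set_ereal_integral N A g =
    enn2ereal (\<integral>\<^sup>+x\<in>A. e2ennreal (g x) \<partial>N) - enn2ereal (\<integral>\<^sup>+x\<in>A. e2ennreal (- g x) \<partial>N)"

(* In the following, F is the joint distribution function belonging to the joint density f.
   Integrals of f are taken in [0, infinity], since a marginal may be infinite on a null set. *)

definition past_density ::
  "(real \<Rightarrow> real \<Rightarrow> real) \<Rightarrow> (real \<Rightarrow> real \<Rightarrow> real) \<Rightarrow> real \<Rightarrow> real \<Rightarrow> real \<Rightarrow> real \<Rightarrow> ennreal" where
  "past_density f F s t x y = ennreal (f x y) / ennreal (F s t)"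

definition past_density_fst ::
  "(real \<Rightarrow> real \<Rightarrow> real) \<Rightarrow> (real \<Rightarrow> real \<Rightarrow> real) \<Rightarrow> real \<Rightarrow> real \<Rightarrow> real \<Rightarrow> ennreal" where
  "past_density_fst f F s t x = (\<integral>\<^sup>+y\<in>{0..t}. ennreal (f x y) \<partial>lborel) / ennreal (F s t)"

definition past_density_snd ::
  "(real \<Rightarrow> real \<Rightarrow> real) \<Rightarrow> (real \<Rightarrow> real \<Rightarrow> real) \<Rightarrow> real \<Rightarrow> real \<Rightarrow> real \<Rightarrow> ennreal" where
  "past_density_snd f F s t y = (\<integral>\<^sup>+x\<in>{0..s}. ennreal (f x y) \<partial>lborel) / ennreal (F s t)"

definition past_mutual_information ::
  "(real \<Rightarrow> real \<Rightarrow> real) \<Rightarrow> (real \<Rightarrow> real \<Rightarrow> real) \<Rightarrow> real \<Rightarrow> real \<Rightarrow> ereal" where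
  "past_mutual_information f F s t =
    set_ereal_integral lborel {0..s} (\<lambda>x. set_ereal_integral lborel {0..t} (\<lambda>y.
      if f x y = 0 then 0
      else enn2ereal (past_density f F s t x y) *
        log_ennreal (past_density f F s t x y /
          (past_density_fst f F s t x * past_density_snd f F s t y))))"

definition past_dependence_denom ::
  "(real \<Rightarrow> real \<Rightarrow> real) \<Rightarrow> real \<Rightarrow> real \<Rightarrow> real \<Rightarrow> real \<Rightarrow> ennreal" where
  "past_dependence_denom f s t x y =
    (\<integral>\<^sup>+v\<in>{0..t}. ennreal (f x v) \<partial>lborel) * (\<integral>\<^sup>+u\<in>{0..s}. ennreal (f u y) \<partial>lborel)"

(* Meaningful only where the denominator is positive; equals 0 where it is infinite. *)
definition past_dependence ::
  "(real \<Rightarrow> real \<Rightarrow> real) \<Rightarrow> real \<Rightarrow> real \<Rightarrow> real \<Rightarrow> real \<Rightarrow> ennreal" where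
  "past_dependence f s t x y = ennreal (f x y) / past_dependence_denom f s t x y"

end

theory Submission
  imports Defs
begin

text \<open>
  With $A(x)$ and $B(y)$ the two integrals in the denominator of $\tilde a$, the likelihood ratio
  inside the logarithm equals $F(s,t)\,\tilde a(x,y;s,t)$ wherever $A(x)$ and $B(y)$ are positive and
  finite, and this holds almost everywhere on $\{f > 0\}$. Hence the integrand is bounded
  above (respectively below) by the conditional density times the constant
  $\log \tilde a(s,t;s,t) + \log F(s,t)$, and the conditional density integrates to $1$. If
  $\tilde a(s,t;s,t) = 0$, this constant is $-\infty$: the lower bound is then trivial, and the
  hypothesis of the upper bound would force $f = 0$ almost everywhere, contradicting $F(s,t) > 0$.
\<close>

section \<open>Extended-real integrals: monotonicity and constant factors\<close>

text \<open>Enlarging the integrand enlarges its positive part and shrinks its negative part.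
  Subtraction in \<open>ereal\<close> respects this even when both parts are infinite, since
  infinity - infinity is infinity there, so the comparison covers arbitrary functions.\<close>

lemma set_ereal_integral_mono_AE:
  assumes "AE x in N. x \<in> A \<longrightarrow> g x \<le> h x"
  shows "set_ereal_integral N A g \<le> set_ereal_integral N A h"
proof -
  have "(\<integral>\<^sup>+x\<in>A. e2ennreal (g x) \<partial>N) \<le> (\<integral>\<^sup>+x\<in>A. e2ennreal (h x) \<partial>N)"
    by (rule nn_integral_mono_AE, rule eventually_mono[OF assms])
      (simp add: e2ennreal_mono split: split_indicator)
  moreover have "(\<integral>\<^sup>+x\<in>A. e2ennreal (- h x) \<partial>N) \<le> (\<integral>\<^sup>+x\<in>A. e2ennreal (- g x) \<partial>N)"
    by (rule nn_integral_mono_AE, rule eventually_mono[OF assms])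
      (simp add: e2ennreal_mono split: split_indicator)
  ultimately show ?thesis
    unfolding set_ereal_integral_def
    by (intro ereal_minus_mono) (simp_all add: less_eq_ennreal.rep_eq)
qed

text \<open>The exceptional null set in \<open>y\<close> may depend on \<open>x\<close>. This
  matches the iterated form of the mutual information and avoids null sets of the product
  measure.\<close>

lemma set_ereal_integral_iterated_mono_AE:
  assumes "AE x in N. x \<in> A \<longrightarrow> (AE y in K. y \<in> B \<longrightarrow> g x y \<le> h x y)"
  shows "set_ereal_integral N A (\<lambda>x. set_ereal_integral K B (g x)) \<le>
    set_ereal_integral N A (\<lambda>x. set_ereal_integral K B (h x))"
  by (rule set_ereal_integral_mono_AE, rule eventually_mono[OF assms])
    (intro impI set_ereal_integral_mono_AE, rule mp)

lemma e2ennreal_cmult: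
  "0 \<le> c \<Longrightarrow> e2ennreal (ereal c * enn2ereal r) = ennreal c * r"
  by (metis e2ennreal_enn2ereal enn2ereal_ennreal times_ennreal.rep_eq)

text \<open>The integrand has constant sign, so one of its two parts integrates to 0 and no infinity
  - infinity arises, whatever the integral of \<open>g\<close>. Both signs of \<open>c\<close> occur
  later, because the logarithmic bound may be negative.\<close>

lemma set_ereal_integral_cmult:
  assumes [measurable]: "g \<in> borel_measurable N" "A \<in> sets N"
  shows "set_ereal_integral N A (\<lambda>x. ereal c * enn2ereal (g x)) =
    ereal c * enn2ereal (\<integral>\<^sup>+x\<in>A. g x \<partial>N)"
proof (cases "0 \<le> c")
  case True
  have "e2ennreal (- (ereal c * enn2ereal r)) = 0" for r
    using True by (intro e2ennreal_neg) simp
  with True show ?thesis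
    unfolding set_ereal_integral_def
    by (simp add: e2ennreal_cmult mult.assoc nn_integral_cmult times_ennreal.rep_eq
        enn2ereal_ennreal zero_ennreal.rep_eq)
next
  case False
  have "e2ennreal (ereal c * enn2ereal r) = 0" for r
    using False by (intro e2ennreal_neg) (simp add: ereal_mult_le_0_iff)
  moreover have "e2ennreal (- (ereal c * enn2ereal r)) = ennreal (- c) * r" for r
    using False e2ennreal_cmult[of "- c" r]
    by (simp add: uminus_ereal.simps(1)[symmetric] del: uminus_ereal.simps)
  ultimately show ?thesis
    using False unfolding set_ereal_integral_def
    by (simp add: mult.assoc nn_integral_cmult times_ennreal.rep_eq
        enn2ereal_ennreal zero_ennreal.rep_eq
        uminus_ereal.simps(1)[symmetric] del: uminus_ereal.simps)
qed

section \<open>Positivity and finiteness of the marginal integrals\<close>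

text \<open>Either the section integral vanishes, and then \<open>f x\<close> is 0 almost everywhere
  on \<open>B\<close>, or it is positive, and then the conclusion holds for every
  \<open>y\<close>.\<close>

lemma AE_section_integral_pos:
  fixes f :: "real \<Rightarrow> real \<Rightarrow> ennreal"
  assumes [measurable]: "case_prod f \<in> borel_measurable (lborel \<Otimes>\<^sub>M lborel)" "B \<in> sets borel"
  shows "AE y in lborel. y \<in> B \<longrightarrow> f x y \<noteq> 0 \<longrightarrow> 0 < (\<integral>\<^sup>+v\<in>B. f x v \<partial>lborel)"
proof (cases "(\<integral>\<^sup>+v\<in>B. f x v \<partial>lborel) = 0")
  case True
  then have "AE y in lborel. f x y * indicator B y = 0"
    by (subst (asm) nn_integral_0_iff_AE) measurable
  then show ?thesis
    by eventually_elim (auto simp: indicator_def)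
next
  case False
  then have "0 < (\<integral>\<^sup>+v\<in>B. f x v \<partial>lborel)"
    using zero_less_iff_neq_zero by blast
  then show ?thesis by simp
qed

text \<open>This describes the points where the likelihood ratio can be computed with real numbers.
  Finiteness of both marginals follows from the finite double integral by Tonelli; positivity
  follows from the preceding dichotomy, applied to the sections in each variable.\<close>

lemma AE_section_integrals_pos_finite:
  fixes f :: "real \<Rightarrow> real \<Rightarrow> ennreal"
  assumes [measurable]: "case_prod f \<in> borel_measurable (lborel \<Otimes>\<^sub>M lborel)"
      "A \<in> sets borel" "B \<in> sets borel"
    and fin: "(\<integral>\<^sup>+x\<in>A. (\<integral>\<^sup>+y\<in>B. f x y \<partial>lborel) \<partial>lborel) < \<infinity>"
  shows "AE x in lborel. x \<in> A \<longrightarrow> (AE y in lborel. y \<in> B \<longrightarrow> f x y \<noteq> 0 \<longrightarrow>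
    0 < (\<integral>\<^sup>+v\<in>B. f x v \<partial>lborel) \<and> (\<integral>\<^sup>+v\<in>B. f x v \<partial>lborel) < \<infinity> \<and>
    0 < (\<integral>\<^sup>+u\<in>A. f u y \<partial>lborel) \<and> (\<integral>\<^sup>+u\<in>A. f u y \<partial>lborel) < \<infinity>)"
proof -
  define Bf where "Bf y = (\<integral>\<^sup>+u\<in>A. f u y \<partial>lborel)" for y
  have [measurable]: "Bf \<in> borel_measurable borel"
    unfolding Bf_def by measurable
  have "(\<integral>\<^sup>+y\<in>B. Bf y \<partial>lborel) = (\<integral>\<^sup>+y. (\<integral>\<^sup>+x. f x y * indicator A x * indicator B y \<partial>lborel) \<partial>lborel)"
    unfolding Bf_def by (simp add: nn_integral_multc)
  also have "\<dots> = (\<integral>\<^sup>+x. (\<integral>\<^sup>+y. f x y * indicator A x * indicator B y \<partial>lborel) \<partial>lborel)"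
    by (rule lborel_pair.Fubini') measurable
  also have "\<dots> = (\<integral>\<^sup>+x\<in>A. (\<integral>\<^sup>+y\<in>B. f x y \<partial>lborel) \<partial>lborel)"
    by (intro nn_integral_cong) (simp split: split_indicator)
  finally have "(\<integral>\<^sup>+y\<in>B. Bf y \<partial>lborel) < \<infinity>"
    using fin by simp
  then have "AE y in lborel. Bf y * indicator B y \<noteq> \<infinity>"
    by (intro nn_integral_PInf_AE) auto
  then have snd_fin: "AE y in lborel. y \<in> B \<longrightarrow> Bf y < \<infinity>"
    by eventually_elim (auto simp: less_top)
  have "AE x in lborel. (\<integral>\<^sup>+y\<in>B. f x y \<partial>lborel) * indicator A x \<noteq> \<infinity>"
    using fin by (intro nn_integral_PInf_AE) auto
  then have fst_fin: "AE x in lborel. x \<in> A \<longrightarrow> (\<integral>\<^sup>+y\<in>B. f x y \<partial>lborel) < \<infinity>"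
    by eventually_elim (auto simp: less_top)
  \<comment> \<open>For the second marginal the dichotomy is applied with the variables exchanged.
    It gives, for every \<open>y\<close>, a null set of \<open>x\<close>; \<open>AE_commute\<close>
    then brings the quantifiers into the order that the conclusion needs.\<close>
  have "(\<lambda>(y, x). f x y) \<in> borel_measurable (lborel \<Otimes>\<^sub>M lborel)"
    by measurable
  then have "AE y in lborel. AE x in lborel. x \<in> A \<longrightarrow> f x y \<noteq> 0 \<longrightarrow> 0 < Bf y"
    unfolding Bf_def by (intro AE_I2 AE_section_integral_pos) auto
  then have "AE x in lborel. AE y in lborel. x \<in> A \<longrightarrow> f x y \<noteq> 0 \<longrightarrow> 0 < Bf y"
    by (subst lborel_pair.AE_commute) measurable
  with fst_fin show ?thesis
  proof eventually_elim
    case (elim x)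
    show ?case
    proof
      assume "x \<in> A"
      have "AE y in lborel. y \<in> B \<longrightarrow> f x y \<noteq> 0 \<longrightarrow> 0 < (\<integral>\<^sup>+v\<in>B. f x v \<partial>lborel)"
        by (rule AE_section_integral_pos) measurable
      with elim(2) snd_fin show "AE y in lborel. y \<in> B \<longrightarrow> f x y \<noteq> 0 \<longrightarrow>
          0 < (\<integral>\<^sup>+v\<in>B. f x v \<partial>lborel) \<and> (\<integral>\<^sup>+v\<in>B. f x v \<partial>lborel) < \<infinity> \<and>
          0 < (\<integral>\<^sup>+u\<in>A. f u y \<partial>lborel) \<and> (\<integral>\<^sup>+u\<in>A. f u y \<partial>lborel) < \<infinity>"
        unfolding Bf_def[symmetric]
        by eventually_elim (use elim(1) \<open>x \<in> A\<close> in auto)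
    qed
  qed
qed

section \<open>Distribution function, likelihood ratio and normalization\<close>

text \<open>Almost sure nonnegativity of \<open>X\<close> and \<open>Y\<close> replaces the
  lower-left quadrant at \<open>(s, t)\<close> by the rectangle, up to a null event; Tonelli then
  iterates the integral of the density.\<close>

lemma joint_cdf_eq_integral:
  assumes "prob_space M"
    and "AE \<omega> in M. 0 \<le> X \<omega>" and "AE \<omega> in M. 0 \<le> Y \<omega>"
    and D: "distributed M (lborel \<Otimes>\<^sub>M lborel) (\<lambda>\<omega>. (X \<omega>, Y \<omega>)) (\<lambda>(x, y). f x y)"
  shows "ennreal (joint_cdf M X Y s t) = (\<integral>\<^sup>+x\<in>{0..s}. (\<integral>\<^sup>+y\<in>{0..t}. f x y \<partial>lborel) \<partial>lborel)"
proof -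
  interpret prob_space M by fact
  note distributed_borel_measurable[OF D, measurable]
  have "(\<lambda>\<omega>. (X \<omega>, Y \<omega>)) \<in> measurable M (lborel \<Otimes>\<^sub>M lborel)"
    using distributed_measurable[OF D] .
  from measurable_compose[OF this measurable_fst] measurable_compose[OF this measurable_snd]
  have [measurable]: "X \<in> borel_measurable M" "Y \<in> borel_measurable M"
    by simp_all
  have "ennreal (joint_cdf M X Y s t) = emeasure M {\<omega> \<in> space M. X \<omega> \<le> s \<and> Y \<omega> \<le> t}"
    unfolding joint_cdf_def by (simp add: emeasure_eq_measure)
  also have "\<dots> = emeasure M ((\<lambda>\<omega>. (X \<omega>, Y \<omega>)) -` ({0..s} \<times> {0..t}) \<inter> space M)"
    by (intro emeasure_eq_AE) (use assms(2,3) in auto)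
  also have "\<dots> = (\<integral>\<^sup>+z\<in>{0..s} \<times> {0..t}. (case z of (x, y) \<Rightarrow> f x y) \<partial>(lborel \<Otimes>\<^sub>M lborel))"
    by (rule distributed_emeasure[OF D]) auto
  also have "\<dots> = (\<integral>\<^sup>+x. (\<integral>\<^sup>+y. f x y * indicator ({0..s} \<times> {0..t}) (x, y) \<partial>lborel) \<partial>lborel)"
    by (subst lborel.nn_integral_fst[symmetric]) (auto)
  also have "\<dots> = (\<integral>\<^sup>+x\<in>{0..s}. (\<integral>\<^sup>+y\<in>{0..t}. f x y \<partial>lborel) \<partial>lborel)"
    by (intro nn_integral_cong) (auto simp: indicator_times split: split_indicator)
  finally show ?thesis .
qed

text \<open>Once the marginals are positive reals \<open>a\<close> and \<open>b\<close>, this is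
  real arithmetic: one factor \<open>1 / F s t\<close> in the numerator against two in the
  denominator leaves \<open>F s t\<close>.\<close>

lemma past_density_ratio:
  assumes "0 < F s t" "0 \<le> f x y"
    and "0 < (\<integral>\<^sup>+v\<in>{0..t}. ennreal (f x v) \<partial>lborel)" "(\<integral>\<^sup>+v\<in>{0..t}. ennreal (f x v) \<partial>lborel) < \<infinity>"
    and "0 < (\<integral>\<^sup>+u\<in>{0..s}. ennreal (f u y) \<partial>lborel)" "(\<integral>\<^sup>+u\<in>{0..s}. ennreal (f u y) \<partial>lborel) < \<infinity>"
  shows "past_density f F s t x y / (past_density_fst f F s t x * past_density_snd f F s t y) =
    ennreal (F s t) * past_dependence f s t x y"
proof -
  obtain a where a: "(\<integral>\<^sup>+v\<in>{0..t}. ennreal (f x v) \<partial>lborel) = ennreal a" "0 < a"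
    using assms(3,4) by (cases "\<integral>\<^sup>+v\<in>{0..t}. ennreal (f x v) \<partial>lborel") (auto simp: less_le)
  obtain b where b: "(\<integral>\<^sup>+u\<in>{0..s}. ennreal (f u y) \<partial>lborel) = ennreal b" "0 < b"
    using assms(5,6) by (cases "\<integral>\<^sup>+u\<in>{0..s}. ennreal (f u y) \<partial>lborel") (auto simp: less_le)
  have "past_density f F s t x y / (past_density_fst f F s t x * past_density_snd f F s t y) =
      ennreal (f x y / F s t / ((a / F s t) * (b / F s t)))"
    unfolding past_density_def past_density_fst_def past_density_snd_def a(1) b(1)
    using a(2) b(2) assms(1,2) by (simp add: divide_ennreal flip: ennreal_mult)
  also have "f x y / F s t / ((a / F s t) * (b / F s t)) = F s t * (f x y / (a * b))"
    using assms(1) by simp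
  also have "ennreal \<dots> = ennreal (F s t) * past_dependence f s t x y"
    unfolding past_dependence_def past_dependence_denom_def a(1) b(1)
    using a(2) b(2) assms(1,2) by (simp add: divide_ennreal flip: ennreal_mult)
  finally show ?thesis .
qed

lemma log_ennreal_mono:
  assumes "a \<le> b"
  shows "log_ennreal a \<le> log_ennreal b"
proof (cases "a = 0 \<or> b = \<infinity>")
  case True
  then show ?thesis by (auto simp: log_ennreal_def)
next
  case False
  then have "0 < a" "a < \<infinity>" "0 < b" "b < \<infinity>"
    using assms by (auto simp: less_top[symmetric] zero_less_iff_neq_zero top_unique)
  moreover from this have "0 < enn2real a"
    by (simp add: enn2real_positive_iff)
  moreover have "enn2real a \<le> enn2real b"
    using assms \<open>b < \<infinity>\<close> by (intro enn2real_mono) auto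
  ultimately show ?thesis
    by (auto simp: log_ennreal_def)
qed

text \<open>This evaluates the comparison function of both bounds. The constant passes through the
  inner integral, which leaves the first conditional marginal, and then through the outer one, where
  that marginal has mass 1 by the integral formula for \<open>F s t\<close>.\<close>

lemma past_density_integral:
  fixes f :: "real \<Rightarrow> real \<Rightarrow> real" and s t :: real
  assumes [measurable]: "(\<lambda>(x, y). ennreal (f x y)) \<in> borel_measurable (lborel \<Otimes>\<^sub>M lborel)"
    and "0 < F s t"
    and "ennreal (F s t) = (\<integral>\<^sup>+x\<in>{0..s}. (\<integral>\<^sup>+y\<in>{0..t}. ennreal (f x y) \<partial>lborel) \<partial>lborel)"
  shows "set_ereal_integral lborel {0..s} (\<lambda>x. set_ereal_integral lborel {0..t} (\<lambda>y.
    ereal c * enn2ereal (past_density f F s t x y))) = ereal c"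
proof -
  have [measurable]: "(\<lambda>(x, y). past_density f F s t x y) \<in> borel_measurable (lborel \<Otimes>\<^sub>M lborel)"
    unfolding past_density_def by measurable
  have inner: "(\<integral>\<^sup>+y\<in>{0..t}. past_density f F s t x y \<partial>lborel) = past_density_fst f F s t x" for x
    unfolding past_density_def past_density_fst_def
    by (subst nn_integral_divide[symmetric]) (auto simp: divide_ennreal_def mult_ac)
  have "(\<integral>\<^sup>+x\<in>{0..s}. past_density_fst f F s t x \<partial>lborel) = ennreal (F s t) / ennreal (F s t)"
    unfolding past_density_fst_def assms(3)
    by (subst nn_integral_divide[symmetric]) (auto simp: divide_ennreal_def mult_ac)
  also have "\<dots> = 1"
    using assms(2) by (simp add: divide_ennreal)
  finally have outer: "(\<integral>\<^sup>+x\<in>{0..s}. past_density_fst f F s t x \<partial>lborel) = 1" .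
  have [measurable]: "past_density_fst f F s t \<in> borel_measurable lborel"
    unfolding past_density_fst_def by measurable
  have "set_ereal_integral lborel {0..t} (\<lambda>y. ereal c * enn2ereal (past_density f F s t x y)) =
      ereal c * enn2ereal (past_density_fst f F s t x)" for x
    unfolding inner[symmetric] by (rule set_ereal_integral_cmult) measurable
  then show ?thesis
    by (simp add: set_ereal_integral_cmult outer one_ennreal.rep_eq)
qed

section \<open>Comparison of the mutual information with the constant at the corner
  \<open>(s, t)\<close>\<close>

theorem proposition1:
  fixes M :: "'a measure" and X Y :: "'a \<Rightarrow> real" and f :: "real \<Rightarrow> real \<Rightarrow> real" and s t :: real
  assumes "prob_space M"
    and "AE \<omega> in M. 0 \<le> X \<omega>" and "AE \<omega> in M. 0 \<le> Y \<omega>"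
    and "\<And>x y. 0 \<le> f x y"
    and "distributed M (lborel \<Otimes>\<^sub>M lborel) (\<lambda>\<omega>. (X \<omega>, Y \<omega>)) (\<lambda>(x, y). ennreal (f x y))"
    and "0 \<le> s" and "0 \<le> t"
    and "0 < joint_cdf M X Y s t"
    and "0 < past_dependence_denom f s t s t"
  shows
    "((\<forall>x\<in>{0..s}. \<forall>y\<in>{0..t}. 0 < past_dependence_denom f s t x y \<longrightarrow>
          past_dependence f s t x y \<le> past_dependence f s t s t) \<longrightarrow>
        past_mutual_information f (joint_cdf M X Y) s t
          \<le> log_ennreal (past_dependence f s t s t) + ereal (ln (joint_cdf M X Y s t))) \<and>
     ((\<forall>x\<in>{0..s}. \<forall>y\<in>{0..t}. 0 < past_dependence_denom f s t x y \<longrightarrow>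
          past_dependence f s t s t \<le> past_dependence f s t x y) \<longrightarrow>
        log_ennreal (past_dependence f s t s t) + ereal (ln (joint_cdf M X Y s t))
          \<le> past_mutual_information f (joint_cdf M X Y) s t)"
proof -
  define F where "F = joint_cdf M X Y"
  define C where "C = past_dependence f s t s t"
  define L where "L = log_ennreal C + ereal (ln (F s t))"
  define g where "g x y = (if f x y = 0 then 0 else enn2ereal (past_density f F s t x y) *
        log_ennreal (past_density f F s t x y /
          (past_density_fst f F s t x * past_density_snd f F s t y)))" for x y
  have MI: "past_mutual_information f F s t =
      set_ereal_integral lborel {0..s} (\<lambda>x. set_ereal_integral lborel {0..t} (g x))"
    unfolding past_mutual_information_def g_def ..
  have F_pos: "0 < F s t"
    using assms(8) by (simp add: F_def)
  have f_meas [measurable]: "(\<lambda>(x, y). ennreal (f x y)) \<in> borel_measurable (lborel \<Otimes>\<^sub>M lborel)"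
    using distributed_borel_measurable[OF assms(5)] .
  have F_eq: "ennreal (F s t) = (\<integral>\<^sup>+x\<in>{0..s}. (\<integral>\<^sup>+y\<in>{0..t}. ennreal (f x y) \<partial>lborel) \<partial>lborel)"
    unfolding F_def by (rule joint_cdf_eq_integral) fact+
  \<comment> \<open>Besides the formula for \<open>g\<close>, two facts are recorded: positivity of
    the denominator, on which the assumed inequalities are conditional, and positivity of
    \<open>past_dependence\<close>, which later excludes \<open>C = 0\<close> in the upper
    bound.\<close>
  have regular: "AE x in lborel. x \<in> {0..s} \<longrightarrow> (AE y in lborel. y \<in> {0..t} \<longrightarrow> f x y \<noteq> 0 \<longrightarrow>
      0 < past_dependence_denom f s t x y \<and> 0 < past_dependence f s t x y \<and>
      g x y = enn2ereal (past_density f F s t x y) *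
        log_ennreal (ennreal (F s t) * past_dependence f s t x y))"
  proof -
    have "(\<integral>\<^sup>+x\<in>{0..s}. (\<integral>\<^sup>+y\<in>{0..t}. ennreal (f x y) \<partial>lborel) \<partial>lborel) < \<infinity>"
      unfolding F_eq[symmetric] by simp
    then have "AE x in lborel. x \<in> {0..s} \<longrightarrow> (AE y in lborel. y \<in> {0..t} \<longrightarrow> ennreal (f x y) \<noteq> 0 \<longrightarrow>
        0 < (\<integral>\<^sup>+v\<in>{0..t}. ennreal (f x v) \<partial>lborel) \<and> (\<integral>\<^sup>+v\<in>{0..t}. ennreal (f x v) \<partial>lborel) < \<infinity> \<and>
        0 < (\<integral>\<^sup>+u\<in>{0..s}. ennreal (f u y) \<partial>lborel) \<and> (\<integral>\<^sup>+u\<in>{0..s}. ennreal (f u y) \<partial>lborel) < \<infinity>)"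
      by (intro AE_section_integrals_pos_finite f_meas) simp_all
    then show ?thesis
    proof eventually_elim
      case (elim x)
      show ?case
      proof
        assume "x \<in> {0..s}"
        from mp[OF elim this] show "AE y in lborel. y \<in> {0..t} \<longrightarrow> f x y \<noteq> 0 \<longrightarrow>
            0 < past_dependence_denom f s t x y \<and> 0 < past_dependence f s t x y \<and>
            g x y = enn2ereal (past_density f F s t x y) *
              log_ennreal (ennreal (F s t) * past_dependence f s t x y)"
        proof eventually_elim
          case (elim y)
          show ?case
          proof (intro impI)
            assume y: "y \<in> {0..t}" "f x y \<noteq> 0"
            then have f_pos: "0 < f x y"
              using assms(4)[of x y] by simp
            then have "ennreal (f x y) \<noteq> 0"
              by simp
            with elim y have
              p: "0 < (\<integral>\<^sup>+v\<in>{0..t}. ennreal (f x v) \<partial>lborel)" "(\<integral>\<^sup>+v\<in>{0..t}. ennreal (f x v) \<partial>lborel) < \<infinity>"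
                "0 < (\<integral>\<^sup>+u\<in>{0..s}. ennreal (f u y) \<partial>lborel)" "(\<integral>\<^sup>+u\<in>{0..s}. ennreal (f u y) \<partial>lborel) < \<infinity>"
              by blast+
            have "0 < past_dependence_denom f s t x y" "past_dependence_denom f s t x y < \<infinity>"
              unfolding past_dependence_denom_def
              using p by (simp_all add: ennreal_zero_less_mult_iff ennreal_mult_less_top)
            \<comment> \<open>Division by infinity gives 0 in \<open>ennreal\<close>, so finiteness
              of the denominator is what keeps the quotient positive.\<close>
            moreover from this(2) have "0 < past_dependence f s t x y"
              unfolding past_dependence_def using f_pos
              by (simp add: ennreal_divide_eq_0_iff zero_less_iff_neq_zero)
            ultimately show "0 < past_dependence_denom f s t x y \<and> 0 < past_dependence f s t x y \<and>
                g x y = enn2ereal (past_density f F s t x y) *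
                  log_ennreal (ennreal (F s t) * past_dependence f s t x y)"
              unfolding g_def past_density_ratio[of F, OF F_pos assms(4) p] using f_pos by simp
          qed
        qed
      qed
    qed
  qed
  \<comment> \<open>A positive denominator at the corner rules out the value infinity that
    \<open>ennreal\<close> gives to a positive number divided by 0.\<close>
  have C_fin: "C < \<infinity>"
    unfolding C_def past_dependence_def using assms(9)
    by (auto simp: less_top[symmetric] ennreal_divide_eq_top_iff)
  \<comment> \<open>For \<open>C\<close> strictly between 0 and infinity the logarithm of the
    product splits. That \<open>L\<close> is then real matters because
    \<open>past_density_integral\<close> takes a real constant.\<close>
  have L_real: "log_ennreal (ennreal (F s t) * C) = L \<and> (\<exists>c. L = ereal c)" if "0 < C"
    using that C_fin F_pos
    by (cases C) (auto simp: L_def log_ennreal_def ennreal_mult[symmetric] ln_mult)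
  have upper: "past_mutual_information f F s t \<le> L"
    if le: "\<forall>x\<in>{0..s}. \<forall>y\<in>{0..t}. 0 < past_dependence_denom f s t x y \<longrightarrow>
      past_dependence f s t x y \<le> C"
  proof -
    have "C \<noteq> 0"
    proof
      assume "C = 0"
      from regular have "AE x in lborel.
          (\<integral>\<^sup>+y\<in>{0..t}. ennreal (f x y) \<partial>lborel) * indicator {0..s} x = 0"
      proof eventually_elim
        case (elim x)
        show ?case
        proof (cases "x \<in> {0..s}")
          case True
          from mp[OF elim True] have "AE y in lborel. ennreal (f x y) * indicator {0..t} y = 0"
          proof eventually_elim
            case (elim y)
            show ?case
            proof (cases "y \<in> {0..t} \<and> f x y \<noteq> 0")
              case nz: True
              with elim have "0 < past_dependence_denom f s t x y" "0 < past_dependence f s t x y"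
                by blast+
              moreover from this(1) have "past_dependence f s t x y \<le> C"
                using le True nz by blast
              ultimately show ?thesis
                using \<open>C = 0\<close> by simp
            qed auto
          qed
          then have "(\<integral>\<^sup>+y\<in>{0..t}. ennreal (f x y) \<partial>lborel) = 0"
            by (subst nn_integral_0_iff_AE) measurable
          then show ?thesis by simp
        qed simp
      qed
      then have "ennreal (F s t) = 0"
        unfolding F_eq by (subst nn_integral_0_iff_AE) measurable
      with F_pos show False by simp
    qed
    with L_real obtain c where c: "L = ereal c" "log_ennreal (ennreal (F s t) * C) = ereal c"
      by (auto simp: zero_less_iff_neq_zero)
    \<comment> \<open>Where \<open>f\<close> vanishes, both sides are 0. Elsewhere
      \<open>regular\<close> rewrites \<open>g\<close> as density times logarithm, and monotonicity
      of the logarithm is multiplied by the nonnegative density. Integrating the right-hand side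
      gives exactly \<open>c\<close>.\<close>
    have "AE x in lborel. x \<in> {0..s} \<longrightarrow> (AE y in lborel. y \<in> {0..t} \<longrightarrow>
        g x y \<le> ereal c * enn2ereal (past_density f F s t x y))"
      using regular
    proof eventually_elim
      case (elim x)
      show ?case
      proof
        assume x: "x \<in> {0..s}"
        from mp[OF elim x] show "AE y in lborel. y \<in> {0..t} \<longrightarrow>
          g x y \<le> ereal c * enn2ereal (past_density f F s t x y)"
        proof eventually_elim
          case (elim y)
          show ?case
          proof
            assume y: "y \<in> {0..t}"
            show "g x y \<le> ereal c * enn2ereal (past_density f F s t x y)"
            proof (cases "f x y = 0")
              case True
              then show ?thesis
                by (simp add: g_def past_density_def zero_ennreal.rep_eq)
            next
              case False
              with elim x y le have "log_ennreal (ennreal (F s t) * past_dependence f s t x y) \<le> ereal c"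
                unfolding c(2)[symmetric] by (intro log_ennreal_mono mult_left_mono) auto
              with False elim y show ?thesis
                by (simp add: mult.commute[of "ereal c"] ereal_mult_left_mono)
            qed
          qed
        qed
      qed
    qed
    from set_ereal_integral_iterated_mono_AE[OF this] show ?thesis
      unfolding MI past_density_integral[of f F s t, OF f_meas F_pos F_eq] c(1) .
  qed
  have lower: "L \<le> past_mutual_information f F s t"
    if le: "\<forall>x\<in>{0..s}. \<forall>y\<in>{0..t}. 0 < past_dependence_denom f s t x y \<longrightarrow>
      C \<le> past_dependence f s t x y"
  proof (cases "C = 0")
    \<comment> \<open>\<open>C = 0\<close> covers both a vanishing density at the corner and an
      infinite denominator there.\<close>
    case True
    then show ?thesis by (simp add: L_def log_ennreal_def)
  next
    case False
    with L_real obtain c where c: "L = ereal c" "log_ennreal (ennreal (F s t) * C) = ereal c"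
      by (auto simp: zero_less_iff_neq_zero)
    \<comment> \<open>The same pointwise comparison with the inequality reversed; the comparison
      function again integrates to \<open>c\<close>, now bounding from below.\<close>
    have "AE x in lborel. x \<in> {0..s} \<longrightarrow> (AE y in lborel. y \<in> {0..t} \<longrightarrow>
        ereal c * enn2ereal (past_density f F s t x y) \<le> g x y)"
      using regular
    proof eventually_elim
      case (elim x)
      show ?case
      proof
        assume x: "x \<in> {0..s}"
        from mp[OF elim x] show "AE y in lborel. y \<in> {0..t} \<longrightarrow>
          ereal c * enn2ereal (past_density f F s t x y) \<le> g x y"
        proof eventually_elim
          case (elim y)
          show ?case
          proof
            assume y: "y \<in> {0..t}"
            show "ereal c * enn2ereal (past_density f F s t x y) \<le> g x y"
            proof (cases "f x y = 0")
              case True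
              then show ?thesis
                by (simp add: g_def past_density_def zero_ennreal.rep_eq)
            next
              case False
              with elim x y le have "ereal c \<le> log_ennreal (ennreal (F s t) * past_dependence f s t x y)"
                unfolding c(2)[symmetric] by (intro log_ennreal_mono mult_left_mono) auto
              with False elim y show ?thesis
                by (simp add: mult.commute[of "ereal c"] ereal_mult_left_mono)
            qed
          qed
        qed
      qed
    qed
    from set_ereal_integral_iterated_mono_AE[OF this] show ?thesis
      unfolding MI past_density_integral[of f F s t, OF f_meas F_pos F_eq] c(1) .
  qed
  from upper lower show ?thesis
    unfolding F_def C_def L_def by blast
qed

end
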